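(* Let the ISL evolution behavior be given, i.e. let $\alpha,\beta\in(0,1)$ be fixed. Then for any maintenance period $k\in[1,+\infty)$, the upper bound of capacity scalability $$\tau(n,k)=\frac{16\sqrt n}{1+\sigma n^{1.5}+4n\bar H_k(\alpha,\beta)}$$ satisfies $$\tau_1(n)\le\tau(n,k)<\tau_\infty(n),$$ where $$\tau_1(n)=\frac{16\sqrt n}{1+\sigma n^{1.5}+4n\,h(\pi_1)},\qquad \tau_\infty(n)=\frac{16\sqrt n}{1+\sigma n^{1.5}+4n\left[\pi_1h(\alpha)+\pi_0h(\beta)\right]}.$$
   Context: $n\ge1$ is the number of satellites, $\sigma$ with $0\le\sigma<\infty$ is the contention overhead per hop, $\alpha$ and $\beta$ are the failure and recovery probabilities of each inter-satellite link (ISL), $h(x)=-x\log_2x-(1-x)\log_2(1-x)$, $\pi_1=\frac{\beta}{\alpha+\beta}$, $\pi_0=\frac{\alpha}{\alpha+\beta}$, and $\bar H_k(\alpha,\beta)=\frac1k\left[h(\pi_1)+(k-1)\left(\pi_1h(\alpha)+\pi_0h(\beta)\right)\right]$.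
   Formalization: The strict bound τ(n,k) < τ_∞(n) is proved only for α+β ≠ 1; when α+β = 1 it is false (e.g. α=β=1/2, n=1, σ=0 gives 16/5 throughout), and τ(n,k) = τ_∞(n) is proved instead. *)

theory Defs
  imports Complex_Main
begin

definition h :: "real \<Rightarrow> real" where
  "h x = - x * log 2 x - (1 - x) * log 2 (1 - x)"

definition pi1 :: "real \<Rightarrow> real \<Rightarrow> real" where
  "pi1 \<alpha> \<beta> = \<beta> / (\<alpha> + \<beta>)"

definition pi0 :: "real \<Rightarrow> real \<Rightarrow> real" where
  "pi0 \<alpha> \<beta> = \<alpha> / (\<alpha> + \<beta>)"

definition Hbar :: "real \<Rightarrow> real \<Rightarrow> real \<Rightarrow> real" where
  "Hbar k \<alpha> \<beta> =
     1 / k * (h (pi1 \<alpha> \<beta>) + (k - 1) * (pi1 \<alpha> \<beta> * h \<alpha> + pi0 \<alpha> \<beta> * h \<beta>))"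

definition tau :: "real \<Rightarrow> real \<Rightarrow> real \<Rightarrow> nat \<Rightarrow> real \<Rightarrow> real" where
  "tau \<sigma> \<alpha> \<beta> n k =
     16 * sqrt (real n) / (1 + \<sigma> * real n powr (3/2) + 4 * real n * Hbar k \<alpha> \<beta>)"

definition tau_1 :: "real \<Rightarrow> real \<Rightarrow> real \<Rightarrow> nat \<Rightarrow> real" where
  "tau_1 \<sigma> \<alpha> \<beta> n =
     16 * sqrt (real n) / (1 + \<sigma> * real n powr (3/2) + 4 * real n * h (pi1 \<alpha> \<beta>))"

definition tau_inf :: "real \<Rightarrow> real \<Rightarrow> real \<Rightarrow> nat \<Rightarrow> real" where
  "tau_inf \<sigma> \<alpha> \<beta> n =
     16 * sqrt (real n) /
       (1 + \<sigma> * real n powr (3/2) + 4 * real n * (pi1 \<alpha> \<beta> * h \<alpha> + pi0 \<alpha> \<beta> * h \<beta>))"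

end

theory Submission
  imports Defs
begin

text \<open>
  Since \<open>h \<alpha> = h (1 - \<alpha>)\<close> and \<open>\<pi>\<^sub>1 (1 - \<alpha>) + \<pi>\<^sub>0 \<beta> = \<pi>\<^sub>1\<close> (stationarity of the link chain), strict
  concavity of \<open>h\<close> shows that the entropy rate \<open>L = \<pi>\<^sub>1 h \<alpha> + \<pi>\<^sub>0 h \<beta>\<close> is at most \<open>H = h \<pi>\<^sub>1\<close>, with
  equality exactly when \<open>1 - \<alpha> = \<beta>\<close>. The average entropy at period \<open>k\<close> equals \<open>L + (H - L) / k\<close>,
  so it exceeds \<open>L\<close> and is at most \<open>H\<close> unless \<open>L = H\<close>, when all three coincide.
\<close>

lemma ln_less_minus_one:
  fixes x :: real
  assumes "0 < x" "x \<noteq> 1"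
  shows "ln x < x - 1"
  using ln_le_minus_one[of x] ln_eq_minus_one[of x] assms by linarith

text \<open>One outcome's share of Gibbs' inequality: \<open>ln t < t - 1\<close> at
  \<open>t = m / x\<close>, scaled by \<open>x\<close>; the factor \<open>ln 2\<close> only changes
  the base.\<close>

lemma mult_log_diff_less:
  fixes x m :: real
  assumes "0 < x" "0 < m" "x \<noteq> m"
  shows "x * (log 2 m - log 2 x) < (m - x) / ln 2"
proof -
  have "ln (m / x) < m / x - 1"
    using assms by (intro ln_less_minus_one) auto
  then have "x * (ln m - ln x) < x * (m / x - 1)"
    using assms by (simp add: ln_div)
  also have "\<dots> = m - x"
    using assms by (simp add: field_simps)
  finally have "x * (ln m - ln x) / ln 2 < (m - x) / ln 2"
    by (simp add: divide_strict_right_mono)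
  then show ?thesis
    by (simp add: log_def diff_divide_distrib right_diff_distrib)
qed

text \<open>For \<open>0 < m < 1\<close> this is, as a function of \<open>x\<close>, the tangent
  line to \<open>h\<close> at \<open>m\<close>.\<close>

definition cross_entropy :: "real \<Rightarrow> real \<Rightarrow> real" where
  "cross_entropy m x = - x * log 2 m - (1 - x) * log 2 (1 - m)"

lemma cross_entropy_self: "cross_entropy m m = h m"
  by (simp add: cross_entropy_def h_def)

text \<open>Gibbs' inequality for two outcomes: the linear bounds for \<open>x\<close> and
  \<open>1 - x\<close> cancel because both distributions have mass 1.\<close>

lemma h_less_cross_entropy:
  assumes "0 < x" "x < 1" "0 < m" "m < 1" "x \<noteq> m"
  shows "h x < cross_entropy m x"
proof -
  have "x * (log 2 m - log 2 x) + (1 - x) * (log 2 (1 - m) - log 2 (1 - x))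
      < (m - x) / ln 2 + ((1 - m) - (1 - x)) / ln 2"
    using assms by (intro add_strict_mono mult_log_diff_less) auto
  also have "\<dots> = 0"
    by (simp flip: add_divide_distrib)
  finally show ?thesis
    by (simp add: h_def cross_entropy_def algebra_simps)
qed

lemma cross_entropy_convex_combination:
  assumes "p + q = 1"
  shows "cross_entropy m (p * x + q * y) = p * cross_entropy m x + q * cross_entropy m y"
proof -
  have q: "q = 1 - p" using assms by simp
  show ?thesis
    unfolding q cross_entropy_def by (simp add: algebra_simps)
qed

text \<open>At both points \<open>h\<close> lies strictly below its tangent at the mean
  \<open>m\<close>; averaging the affine tangent returns its value at \<open>m\<close>, which is
  \<open>h m\<close>.\<close>

lemma h_strictly_concave:
  assumes "0 < x" "x < 1" "0 < y" "y < 1" "x \<noteq> y" "0 < p" "0 < q" "p + q = 1"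
  shows "p * h x + q * h y < h (p * x + q * y)"
proof -
  define m where "m = p * x + q * y"
  have q: "q = 1 - p" using assms by simp
  have mx: "m - x = q * (y - x)" and my: "m - y = p * (x - y)"
    by (simp_all add: m_def q algebra_simps)
  have ne: "x \<noteq> m" "y \<noteq> m"
    using mx my assms by auto
  have "m < p * 1 + q * 1"
    unfolding m_def using assms by (intro add_strict_mono mult_strict_left_mono) auto
  then have m: "0 < m" "m < 1"
    using assms by (auto simp: m_def intro: add_pos_pos)
  have "p * h x + q * h y < p * cross_entropy m x + q * cross_entropy m y"
    using assms m ne by (intro add_strict_mono mult_strict_left_mono h_less_cross_entropy) auto
  also have "\<dots> = h m"
    using cross_entropy_convex_combination[of p q m x y] assms
    by (simp add: m_def flip: cross_entropy_self)
  finally show ?thesis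
    by (simp add: m_def)
qed

lemma h_pos:
  assumes "0 < x" "x < 1"
  shows "0 < h x"
proof -
  have "x * log 2 x < 0" "(1 - x) * log 2 (1 - x) < 0"
    using assms by (auto intro!: mult_pos_neg)
  then show ?thesis by (simp add: h_def)
qed

lemma h_one_minus: "h (1 - x) = h x"
  by (simp add: h_def algebra_simps)

text \<open>Strictness is confined to \<open>\<alpha> + \<beta> \<noteq> 1\<close>. If the sum is 1,
  successive link states are independent, knowing the last state saves no entropy, and the upper
  bound is attained.\<close>

theorem corollary4:
  fixes n :: nat and \<sigma> \<alpha> \<beta> k :: real
  assumes "n \<ge> 1" and "0 \<le> \<sigma>"
    and "0 < \<alpha>" and "\<alpha> < 1" and "0 < \<beta>" and "\<beta> < 1"
    and "1 \<le> k"
  shows "tau_1 \<sigma> \<alpha> \<beta> n \<le> tau \<sigma> \<alpha> \<beta> n k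
    \<and> (\<alpha> + \<beta> \<noteq> 1 \<longrightarrow> tau \<sigma> \<alpha> \<beta> n k < tau_inf \<sigma> \<alpha> \<beta> n)
    \<and> (\<alpha> + \<beta> = 1 \<longrightarrow> tau \<sigma> \<alpha> \<beta> n k = tau_inf \<sigma> \<alpha> \<beta> n)"
proof -
  define p q where "p = pi1 \<alpha> \<beta>" and "q = pi0 \<alpha> \<beta>"
  define L where "L = p * h \<alpha> + q * h \<beta>"
  define c where "c = 1 + \<sigma> * real n powr (3/2)"
  have s: "0 < \<alpha> + \<beta>" using assms by simp
  have pq: "0 < p" "0 < q" "p + q = 1"
    using assms s by (simp_all add: p_def q_def pi1_def pi0_def flip: add_divide_distrib)
  have p_eq: "p * (1 - \<alpha>) + q * \<beta> = p"
    by (simp add: p_def q_def pi1_def pi0_def right_diff_distrib mult.commute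
        flip: add_divide_distrib)
  have L_less: "L < h p" if "\<alpha> + \<beta> \<noteq> 1"
    using h_strictly_concave[of "1 - \<alpha>" \<beta> p q] assms pq p_eq that
    by (auto simp: L_def h_one_minus)
  have L_eq: "L = h p" if "\<alpha> + \<beta> = 1"
  proof -
    \<comment> \<open>Both conditional entropies equal \<open>h \<beta>\<close>, and
      \<open>\<beta>\<close> is also the stationary probability.\<close>
    have \<alpha>: "\<alpha> = 1 - \<beta>" using that by simp
    have "p = \<beta>" using that by (simp add: p_def pi1_def)
    moreover have "L = (p + q) * h \<beta>"
      by (simp add: L_def \<alpha> h_one_minus distrib_right)
    ultimately show ?thesis using pq by simp
  qed
  have L_pos: "0 < L"
    unfolding L_def using pq assms by (intro add_pos_pos mult_pos_pos h_pos) auto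
  have Hbar: "Hbar k \<alpha> \<beta> = L + (h p - L) / k"
    using assms by (simp add: Hbar_def L_def p_def q_def field_simps)
  have L_le: "L \<le> h p"
    using L_less L_eq by linarith
  then have "(h p - L) / k \<le> h p - L"
    using assms mult_left_mono[of 1 k "h p - L"] by (simp add: divide_le_eq)
  then have Hbar_le: "Hbar k \<alpha> \<beta> \<le> h p"
    by (simp add: Hbar)
  have Hbar_ge: "L \<le> Hbar k \<alpha> \<beta>"
    using L_le assms by (simp add: Hbar)
  have c: "0 < c" using assms by (simp add: c_def add_pos_nonneg)
  have n: "0 < real n" using assms by simp
  \<comment> \<open>\<open>L\<close> is the least of the three entropies compared, so this covers
    every denominator.\<close>
  have den: "0 < c + 4 * real n * x" if "L \<le> x" for x
    using that L_pos c n by (intro add_pos_pos mult_pos_pos) auto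
  have "tau_1 \<sigma> \<alpha> \<beta> n \<le> tau \<sigma> \<alpha> \<beta> n k"
    unfolding tau_1_def tau_def c_def[symmetric] p_def[symmetric]
    using den[OF L_le] den[OF Hbar_ge] Hbar_le n by (intro divide_left_mono mult_pos_pos) auto
  moreover have "tau \<sigma> \<alpha> \<beta> n k < tau_inf \<sigma> \<alpha> \<beta> n" if "\<alpha> + \<beta> \<noteq> 1"
  proof -
    \<comment> \<open>The gap \<open>(h p - L) / k\<close> stays positive for every finite
      \<open>k\<close>.\<close>
    have "L < Hbar k \<alpha> \<beta>"
      using L_less[OF that] assms by (simp add: Hbar)
    then show ?thesis
      unfolding tau_inf_def tau_def c_def[symmetric] p_def[symmetric] q_def[symmetric]
        L_def[symmetric]
      using den[OF order_refl] den[OF Hbar_ge] n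
      by (intro divide_strict_left_mono mult_pos_pos) auto
  qed
  moreover have "tau \<sigma> \<alpha> \<beta> n k = tau_inf \<sigma> \<alpha> \<beta> n" if "\<alpha> + \<beta> = 1"
    unfolding tau_inf_def tau_def p_def[symmetric] q_def[symmetric] L_def[symmetric]
    using L_eq[OF that] by (simp add: Hbar)
  ultimately show ?thesis by blast
qed

end
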